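(* Let $\lambda$ be a number and let $p(x)=\lambda(x+1)x$. Define the iterates of $p$ by $p^{(0)}(x)=x$ and $p^{(n)}(x)=p^{(n-1)}(p(x))$ for $n\in\mathbb{N}=\{1,2,3,\dots\}$. Then for every $n\in\mathbb{N}$, $$ p^{(n)}(x)=\sum_{k=1}^{2^n}x^k\sum_{i=(k-1)\omega_n}^{k\omega_n-1}\ \prod_{j=1}^n \lambda^{\mu_{i,j-1}}\binom{\mu_{i,j-1}}{\mu_{i,j}-\mu_{i,j-1}}, $$ where $\omega_m=2^{\frac{m(m-1)}{2}}$ for integers $m\ge 0$ and $$ \mu_{i,j}=\left\lceil \frac{1+(i \bmod \omega_{j+1})}{\omega_j}\right\rceil $$ for integers $i,j\ge 0$.
   Context: "Number" means complex number, and the identity is an identity of polynomials in $x$. Here $i \bmod m\in\{0,\dots,m-1\}$ is the remainder of $i$ on division by $m$. Binomial coefficients $\binom{a}{b}$ with $a$ a nonnegative integer follow the usual convention $\binom{a}{b}=0$ if $b<0$ or $b>a$. *)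

theory Defs
  imports Complex_Main "HOL-Computational_Algebra.Polynomial"
begin

definition p_poly :: "complex \<Rightarrow> complex poly" where
  "p_poly lam = smult lam ([:1, 1:] * [:0, 1:])"

primrec p_iter :: "complex \<Rightarrow> nat \<Rightarrow> complex poly" where
  "p_iter lam 0 = [:0, 1:]"
| "p_iter lam (Suc n) = pcompose (p_iter lam n) (p_poly lam)"

definition omega :: "nat \<Rightarrow> nat" where
  "omega m = 2 ^ (m * (m - 1) div 2)"

text \<open>The ceiling is at least 1, so the conversion by \<open>nat\<close> loses nothing.\<close>

definition mu :: "nat \<Rightarrow> nat \<Rightarrow> nat" where
  "mu i j = nat \<lceil>(1 + real (i mod omega (j + 1))) / real (omega j)\<rceil>"

text \<open>The lower argument may be negative, in which case the coefficient is 0.\<close>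

definition binom :: "nat \<Rightarrow> int \<Rightarrow> nat" where
  "binom a b = (if b < 0 then 0 else a choose nat b)"

end

theory Submission
  imports Defs
begin

text \<open>
  Since \<open>p(x)\<close> is \<open>\<lambda> x (1 + x)\<close>, the coefficient of \<open>x^b\<close> in \<open>p(x)^a\<close> is
  \<open>\<lambda>^a\<close> times \<open>a choose (b - a)\<close>; call it the weight of the step from \<open>a\<close> to \<open>b\<close>.
  Substituting \<open>p\<close> into the \<open>n\<close>-th iterate multiplies its coefficient vector by the matrix
  of these weights. Starting from the polynomial \<open>x\<close>, the coefficient of \<open>x^k\<close> in the
  \<open>n\<close>-th iterate is therefore the sum over all chains \<open>1 = m_0, m_1, ..., m_n = k\<close> of the
  products of the step weights, where \<open>m_j\<close> may be restricted to \<open>1..2^j\<close> because the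
  \<open>j\<close>-th iterate has degree at most \<open>2^j\<close> and no constant term.

  The index \<open>i\<close> merely enumerates these chains. As \<open>omega (j + 1)\<close> is \<open>2^j\<close> times
  \<open>omega j\<close>, the numbers \<open>omega j\<close> are the place values of a mixed radix system whose
  \<open>j\<close>-th digit has \<open>2^j\<close> possible values, and \<open>mu i j\<close> is one plus the \<open>j\<close>-th digit of
  \<open>i\<close> (\<open>mu_digit\<close>). The block of indices belonging to \<open>k\<close> consists of the numbers whose
  \<open>n\<close>-th digit is \<open>k - 1\<close>, while the lower digits run through all possibilities.
  Splitting such a block by its second highest digit yields the same recurrence
  (\<open>block_sum_Suc\<close>) as composition with \<open>p\<close>, and induction on \<open>n\<close> finishes the proof.
\<close>

lemma omega_pos: "omega m > 0"
  by (simp add: omega_def)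

lemma omega_Suc: "omega (Suc m) = 2 ^ m * omega m"
proof -
  have "Suc m * (Suc m - 1) div 2 = m + m * (m - 1) div 2"
    by (cases m) (simp_all add: algebra_simps)
  then show ?thesis
    by (simp add: omega_def power_add)
qed

lemma omega_dvd_mono: "m \<le> n \<Longrightarrow> omega m dvd omega n"
  by (induction rule: dec_induct) (auto simp: omega_Suc)

text \<open>The ceiling of \<open>(1 + a) / w\<close> is the quotient of \<open>a\<close> by \<open>w\<close> plus one, because
  \<open>a\<close> and \<open>w\<close> are integers.\<close>

lemma mu_digit: "mu i j = i mod omega (Suc j) div omega j + 1"
proof -
  let ?a = "i mod omega (Suc j)" and ?w = "omega j"
  have a: "?a div ?w * ?w \<le> ?a" "?a + 1 \<le> (?a div ?w + 1) * ?w"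
    using dividend_less_div_times[OF omega_pos, of ?a j] by simp_all
  have "real (?a div ?w) * real ?w \<le> real ?a"
    "1 + real ?a \<le> (real (?a div ?w) + 1) * real ?w"
    using a[THEN of_nat_mono[where 'a = real]] by (simp_all add: algebra_simps)
  then have "\<lceil>(1 + real ?a) / real ?w\<rceil> = int (?a div ?w + 1)"
    using omega_pos[of j] by (intro ceiling_unique) (simp_all add: field_simps)
  then show ?thesis
    by (simp add: mu_def)
qed

text \<open>Reduction modulo \<open>omega (n + 1)\<close> removes exactly the digits in positions above \<open>n\<close>.\<close>

lemma mu_mod: "j \<le> n \<Longrightarrow> mu (i mod omega (Suc n)) j = mu i j"
  by (simp add: mu_digit mod_mod_cancel omega_dvd_mono)

text \<open>The bound \<open>2 ^ n\<close> on \<open>k\<close> keeps the block below \<open>omega (n + 1)\<close>, so that the reduction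
  in the definition of \<open>mu\<close> does not change its elements.\<close>

lemma mu_block:
  assumes "k \<in> {1..2 ^ n}" "i \<in> {(k - 1) * omega n..<k * omega n}"
  shows "mu i n = k"
proof -
  obtain k' where k: "k = Suc k'" using assms(1) by (cases k) auto
  have "k * omega n \<le> omega (Suc n)"
    using assms(1) by (simp add: omega_Suc)
  with assms(2) have "i mod omega (Suc n) = i" by simp
  moreover have "i div omega n = k'"
    using assms(2) by (intro div_nat_eqI) (simp_all add: k mult.commute)
  ultimately show ?thesis
    by (simp add: mu_digit k)
qed

definition step_weight :: "complex \<Rightarrow> nat \<Rightarrow> nat \<Rightarrow> complex" where
  "step_weight lam a b = lam ^ a * of_nat (binom a (int b - int a))"

definition chain_weight :: "complex \<Rightarrow> nat \<Rightarrow> nat \<Rightarrow> complex" where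
  "chain_weight lam n i = (\<Prod>j = 1..n. step_weight lam (mu i (j - 1)) (mu i j))"

definition block_sum :: "complex \<Rightarrow> nat \<Rightarrow> nat \<Rightarrow> complex" where
  "block_sum lam n k = (\<Sum>i = (k - 1) * omega n..<k * omega n. chain_weight lam n i)"

lemma chain_weight_mod: "chain_weight lam n (i mod omega (Suc n)) = chain_weight lam n i"
  unfolding chain_weight_def by (intro prod.cong) (auto simp: mu_mod)

lemma chain_weight_Suc:
  "chain_weight lam (Suc n) i =
     chain_weight lam n i * step_weight lam (mu i n) (mu i (Suc n))"
  by (simp add: chain_weight_def)

text \<open>Expand \<open>\<lambda>^m x^m (1 + x)^m\<close> by the binomial theorem.\<close>

lemma coeff_p_poly_power: "coeff (p_poly lam ^ m) k = step_weight lam m k"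
proof -
  have "p_poly lam ^ m = smult (lam ^ m) ([:1, 1:] ^ m * monom 1 m)"
    by (simp only: p_poly_def smult_power power_mult_distrib monom_altdef smult_1_left)
  moreover have "coeff ([:1, 1:] ^ m) i = (of_nat (m choose i) :: complex)" for i
    by (cases "i \<le> m") (simp_all add: coeff_linear_poly_power coeff_eq_0 degree_linear_power)
  moreover have "nat (int k - int m) = k - m" by simp
  ultimately show ?thesis
    by (auto simp: step_weight_def binom_def coeff_monom_mult mult.commute[of _ "monom 1 m"])
qed

lemma pcompose_monom: "pcompose (monom a k) q = smult a (q ^ k)"
  for a :: "'a::comm_semiring_1"
  by (induction k) (simp_all add: monom_0 monom_Suc pcompose_pCons)

lemma step_weight_eq_0: "k = 0 \<or> 2 * m < k \<Longrightarrow> m \<ge> 1 \<Longrightarrow> step_weight lam m k = 0"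
  by (auto simp: step_weight_def binom_def)

text \<open>Writing the indices of the block of \<open>k\<close> as \<open>i + (k - 1) omega (n + 1)\<close> with
  \<open>i < omega (n + 1)\<close> fixes the top digit. The range of \<open>i\<close> is the disjoint union of
  \<open>2 ^ n\<close> blocks of length \<open>omega n\<close>, on each of which the digit in position \<open>n\<close>, and
  hence the weight of the last step, is constant.\<close>

lemma block_sum_Suc:
  assumes "k \<in> {1..2 ^ Suc n}"
  shows "block_sum lam (Suc n) k =
    (\<Sum>m = 1..2 ^ n. block_sum lam n m * step_weight lam m k)"
proof -
  let ?W = "omega (Suc n)" and ?w = "omega n"
  let ?f = "\<lambda>i. chain_weight lam n i * step_weight lam (mu i n) k"
  obtain k' where k: "k = Suc k'" using assms by (cases k) auto
  have "block_sum lam (Suc n) k =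
      (\<Sum>i = 0 + k' * ?W..<?W + k' * ?W. chain_weight lam (Suc n) i)"
    by (simp add: block_sum_def k)
  also have "\<dots> = (\<Sum>i = 0..<?W. chain_weight lam (Suc n) (i + k' * ?W))"
    by (rule sum.shift_bounds_nat_ivl)
  also have "\<dots> = (\<Sum>i = 0..<?W. ?f i)"
  proof (intro sum.cong refl)
    fix i assume i: "i \<in> {0..<?W}"
    have "mu (i + k' * ?W) (Suc n) = k"
      using i assms by (intro mu_block) (auto simp: k)
    moreover have "(i + k' * ?W) mod ?W = i" using i by simp
    then have "chain_weight lam n (i + k' * ?W) = chain_weight lam n i"
      "mu (i + k' * ?W) n = mu i n"
      by (metis chain_weight_mod, metis mu_mod order_refl)
    ultimately show "chain_weight lam (Suc n) (i + k' * ?W) = ?f i"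
      by (simp add: chain_weight_Suc)
  qed
  also have "\<dots> = (\<Sum>m<2 ^ n. \<Sum>i = m * ?w..<m * ?w + ?w. ?f i)"
    by (simp only: sum.nat_group omega_Suc flip: lessThan_atLeast0)
  also have "\<dots> = (\<Sum>m<2 ^ n. block_sum lam n (Suc m) * step_weight lam (Suc m) k)"
  proof (intro sum.cong refl)
    fix m :: nat assume m: "m \<in> {..<2 ^ n}"
    have "mu i n = Suc m" if "i \<in> {m * ?w..<m * ?w + ?w}" for i
      using m that by (intro mu_block) (auto simp: add.commute)
    then show "(\<Sum>i = m * ?w..<m * ?w + ?w. ?f i) =
        block_sum lam n (Suc m) * step_weight lam (Suc m) k"
      by (simp add: block_sum_def sum_distrib_right add.commute)
  qed
  also have "\<dots> = (\<Sum>m = 1..2 ^ n. block_sum lam n m * step_weight lam m k)"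
    by (simp add: sum.atLeast1_atMost_eq)
  finally show ?thesis .
qed

text \<open>The block sums satisfy the recurrence of the coefficients of the iterates. It is stated
  from \<open>n = 0\<close> on, where the only block is \<open>{0}\<close>, carrying the empty product.\<close>

lemma p_iter_eq_block_sums: "p_iter lam n = (\<Sum>k = 1..2 ^ n. monom (block_sum lam n k) k)"
proof (induction n)
  case 0
  show ?case
    by (simp add: block_sum_def chain_weight_def omega_def monom_altdef)
next
  case (Suc n)
  have "p_iter lam (Suc n) = (\<Sum>m = 1..2 ^ n. smult (block_sum lam n m) (p_poly lam ^ m))"
    using Suc by (simp add: pcompose_sum pcompose_monom)
  show ?case
  proof (rule poly_eqI)
    fix k
    have "coeff (p_iter lam (Suc n)) k =
        (\<Sum>m = 1..2 ^ n. block_sum lam n m * step_weight lam m k)"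
      by (simp add: \<open>p_iter lam (Suc n) = _\<close> coeff_sum coeff_p_poly_power del: p_iter.simps)
    also have "\<dots> = (if k \<in> {1..2 ^ Suc n} then block_sum lam (Suc n) k else 0)"
    proof (cases "k \<in> {1..2 ^ Suc n}")
      case True
      then show ?thesis by (simp only: block_sum_Suc if_True)
    next
      case False
      then have "step_weight lam m k = 0" if "m \<in> {1..2 ^ n}" for m
        using that by (intro step_weight_eq_0) auto
      then show ?thesis using False by (simp only: if_False mult_zero_right sum.neutral_const cong: sum.cong)
    qed
    also have "\<dots> = coeff (\<Sum>k = 1..2 ^ Suc n. monom (block_sum lam (Suc n) k) k) k"
      by (simp add: coeff_sum sum.delta)
    finally show "coeff (p_iter lam (Suc n)) k = \<dots>" .
  qed
qed

theorem theorem3p1: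
  fixes lam :: complex and n :: nat
  assumes "n \<ge> 1"
  shows "p_iter lam n =
    (\<Sum>k = 1..2 ^ n. monom
      (\<Sum>i = (k - 1) * omega n..k * omega n - 1.
        \<Prod>j = 1..n. lam ^ mu i (j - 1) *
          of_nat (binom (mu i (j - 1)) (int (mu i j) - int (mu i (j - 1))))) k)"
proof -
  have "{(k - 1) * omega n..k * omega n - 1} = {(k - 1) * omega n..<k * omega n}"
    if "k \<in> {1..2 ^ n}" for k
  proof -
    have "k * omega n > 0" using that omega_pos[of n] by simp
    then have "k * omega n = Suc (k * omega n - 1)" by simp
    then show ?thesis by (metis atLeastLessThanSuc_atLeastAtMost)
  qed
  then show ?thesis
    by (simp add: p_iter_eq_block_sums block_sum_def chain_weight_def step_weight_def)
qed

end
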